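(* Let $B$ be a unital algebra over a field $K$ and let $\beta\in\mathrm{Mul}[[B]]$. Then the unsymmetrized R-transform $\widetilde R_\beta$ is the unique element of $\mathrm{Mul}[[B]]$ satisfying $$(I+I\beta I)^{\langle-1\rangle}=(1+I\,\widetilde R_\beta)^{-1}I.$$
   Context: $\mathrm{Mul}[[B]]$ is the set of sequences $\alpha=(\alpha_0,\alpha_1,\alpha_2,\ldots)$ with $\alpha_0\in B$ and, for $n\ge1$, $\alpha_n:B\times\cdots\times B\to B$ an $n$-multilinear ($K$-multilinear) map. Addition is termwise. The formal product is $(\alpha\beta)_n(b_1,\ldots,b_n)=\sum_{k=0}^n\alpha_k(b_1,\ldots,b_k)\beta_{n-k}(b_{k+1},\ldots,b_n)$ (with $(\alpha\beta)_0=\alpha_0\beta_0$). If $\beta_0=0$, the formal composition $\alpha\circ\beta$ is given by $(\alpha\circ\beta)_0=\alpha_0$ and, for $n\ge1$, $$(\alpha\circ\beta)_n(b_1,\ldots,b_n)=\sum_{k=1}^n\ \sum_{\substack{p_1,\ldots,p_k\ge1 \\ p_1+\cdots+p_k=n}}\alpha_k\big(\beta_{p_1}(b_{q_1+1},\ldots,b_{q_1+p_1}),\ldots,\beta_{p_k}(b_{q_k+1},\ldots,b_{q_k+p_k})\big),$$ where $q_j=p_1+\cdots+p_{j-1}$ (so $q_1=0$). Put $1=(1,0,0,\ldots)$ (identity for the formal product) and $I=(0,\mathrm{id}_B,0,0,\ldots)$ (identity for formal composition). $\alpha^{-1}$ denotes the inverse with respect to the formal product (it exists iff $\alpha_0$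 is invertible) and $\alpha^{\langle-1\rangle}$ the inverse with respect to formal composition (for $\alpha_0=0$ it exists iff $\alpha_1$ is an invertible linear map $B\to B$). All products are formal products. The unsymmetrized R-transform of $\beta\in\mathrm{Mul}[[B]]$ is defined by $\widetilde R_\beta=\big((1+\beta I)^{-1}\beta\big)\circ(I+I\beta I)^{\langle-1\rangle}$. *)

theory Defs
  imports Complex_Main
begin

text \<open>The sort \<open>{ring, monoid_mult}\<close> is that of unital associative rings; unlike \<open>ring_1\<close>
  it does not exclude the zero ring.\<close>

locale unital_algebra = vector_space scale
  for scale :: "'k::field \<Rightarrow> 'b::{ring,monoid_mult} \<Rightarrow> 'b" (infixr "*s" 75) +
  assumes scale_mult_left: "(a *s x) * y = a *s (x * y)"
    and scale_mult_right: "x * (a *s y) = a *s (x * y)"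

text \<open>A sequence \<open>\<alpha>\<^sub>0 \<in> B\<close>, \<open>\<alpha>\<^sub>n : B\<^sup>n \<rightarrow> B\<close> is encoded as a single function on lists:
  \<open>\<alpha>\<^sub>n(b\<^sub>1,\<dots>,b\<^sub>n)\<close> is \<open>\<alpha> [b\<^sub>1,\<dots>,b\<^sub>n]\<close>, and \<open>\<alpha>\<^sub>0\<close> is \<open>\<alpha> []\<close>. Since lists are the disjoint union
  of the powers \<open>B\<^sup>n\<close>, equality of such functions is termwise equality of sequences.\<close>

type_synonym 'b mulseq = "'b list \<Rightarrow> 'b"

definition Mul :: "('k::field \<Rightarrow> 'b::{ring,monoid_mult} \<Rightarrow> 'b) \<Rightarrow> 'b mulseq set" where
  "Mul scale = {\<alpha>. \<forall>xs ys. Vector_Spaces.linear scale scale (\<lambda>b. \<alpha> (xs @ b # ys))}"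

definition mul_add :: "'b::{ring,monoid_mult} mulseq \<Rightarrow> 'b mulseq \<Rightarrow> 'b mulseq" (infixl "\<oplus>" 65) where
  "\<alpha> \<oplus> \<beta> = (\<lambda>bs. \<alpha> bs + \<beta> bs)"

definition mul_prod :: "'b::{ring,monoid_mult} mulseq \<Rightarrow> 'b mulseq \<Rightarrow> 'b mulseq" (infixl "\<otimes>" 70) where
  "\<alpha> \<otimes> \<beta> = (\<lambda>bs. \<Sum>k=0..length bs. \<alpha> (take k bs) * \<beta> (drop k bs))"

definition int_compositions :: "nat \<Rightarrow> nat \<Rightarrow> nat list set" where
  "int_compositions n k = {ps. length ps = k \<and> (\<forall>p\<in>set ps. p \<ge> 1) \<and> sum_list ps = n}"

text \<open>Formal composition; only meaningful when \<open>\<beta> [] = 0\<close>. With indices \<open>j\<close> counted from \<open>0\<close>,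
  \<open>q\<^sub>j = sum_list (take j ps)\<close> is the number of arguments consumed by the preceding blocks.\<close>

definition mul_comp :: "'b::{ring,monoid_mult} mulseq \<Rightarrow> 'b mulseq \<Rightarrow> 'b mulseq" (infixl "\<odot>" 72) where
  "\<alpha> \<odot> \<beta> = (\<lambda>bs. if bs = [] then \<alpha> [] else
     (\<Sum>k=1..length bs. \<Sum>ps\<in>int_compositions (length bs) k.
        \<alpha> (map (\<lambda>j. \<beta> (take (ps ! j) (drop (sum_list (take j ps)) bs))) [0..<k])))"

definition mul_one :: "'b::{ring,monoid_mult} mulseq" where
  "mul_one = (\<lambda>bs. if bs = [] then 1 else 0)"

definition mul_id :: "'b::{ring,monoid_mult} mulseq" where
  "mul_id = (\<lambda>bs. case bs of [b] \<Rightarrow> b | _ \<Rightarrow> 0)"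

definition prod_inverse ::
  "('k::field \<Rightarrow> 'b::{ring,monoid_mult} \<Rightarrow> 'b) \<Rightarrow> 'b mulseq \<Rightarrow> 'b mulseq" where
  "prod_inverse scale \<alpha> =
     (THE \<gamma>. \<gamma> \<in> Mul scale \<and> \<alpha> \<otimes> \<gamma> = mul_one \<and> \<gamma> \<otimes> \<alpha> = mul_one)"

text \<open>The condition \<open>\<gamma> [] = 0\<close> makes the composition \<open>\<alpha> \<odot> \<gamma>\<close> legitimate; the notion is used
  only for \<open>\<alpha>\<close> with \<open>\<alpha> [] = 0\<close>.\<close>

definition comp_inverse ::
  "('k::field \<Rightarrow> 'b::{ring,monoid_mult} \<Rightarrow> 'b) \<Rightarrow> 'b mulseq \<Rightarrow> 'b mulseq" where
  "comp_inverse scale \<alpha> =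
     (THE \<gamma>. \<gamma> \<in> Mul scale \<and> \<gamma> [] = 0 \<and> \<alpha> \<odot> \<gamma> = mul_id \<and> \<gamma> \<odot> \<alpha> = mul_id)"

definition R_tilde ::
  "('k::field \<Rightarrow> 'b::{ring,monoid_mult} \<Rightarrow> 'b) \<Rightarrow> 'b mulseq \<Rightarrow> 'b mulseq" where
  "R_tilde scale \<beta> =
     (prod_inverse scale (mul_one \<oplus> \<beta> \<otimes> mul_id) \<otimes> \<beta>)
       \<odot> comp_inverse scale (mul_id \<oplus> mul_id \<otimes> \<beta> \<otimes> mul_id)"

end

theory Submission
  imports Defs "HOL-Library.FuncSet"
begin

text \<open>
  Write \<open>\<sigma> = (I + I\<beta>I)\<^sup>\<langle>\<^sup>-\<^sup>1\<^sup>\<rangle>\<close> and \<open>b = \<beta> \<circ> \<sigma>\<close>. Composition on the right with \<open>\<sigma>\<close> is a homomorphism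
  for the formal sum and product, and sends \<open>I\<close> to \<open>\<sigma>\<close>
  (\<open>mul_comp_add\<close>, \<open>mul_prod_comp\<close>, \<open>mul_one_comp\<close>, \<open>mul_id_comp\<close>). Hence the defining equation
  \<open>(I(1 + \<beta>I)) \<circ> \<sigma> = I\<close> reads \<open>\<sigma>(1 + b\<sigma>) = I\<close>, and the R-transform of \<open>\<beta>\<close> is
  \<open>R = (1 + b\<sigma>)\<^sup>-\<^sup>1b\<close>. So \<open>IR = \<sigma>(1 + b\<sigma>)(1 + b\<sigma>)\<^sup>-\<^sup>1b = \<sigma>b\<close>, and
  \<open>(1 + IR)\<sigma> = \<sigma> + \<sigma>b\<sigma> = \<sigma>(1 + b\<sigma>) = I\<close>, which is the claimed formula
  \<open>\<sigma> = (1 + IR)\<^sup>-\<^sup>1I\<close>.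

  For uniqueness, if also \<open>(1 + I\<rho>)\<sigma> = I\<close>, then \<open>I\<rho>\<sigma> = IR\<sigma>\<close>; multiplying on the right by
  \<open>1 + b\<sigma>\<close> gives \<open>I\<rho>I = IRI\<close>. As \<open>(I\<rho>I)(1, b\<^sub>1, \<dots>, b\<^sub>n, 1) = \<rho>(b\<^sub>1, \<dots>, b\<^sub>n)\<close>, this yields \<open>\<rho> = R\<close>.

  The rest of the work is to show that both kinds of inverse exist, are unique and stay
  multilinear, since otherwise the definite descriptions defining them would denote nothing in
  particular. A formal product inverse of \<open>1 + \<xi>\<close> with \<open>\<xi>\<^sub>0 = 0\<close> is obtained by composing \<open>\<xi>\<close> into
  the geometric series, the inverse of \<open>1 + I\<close> (\<open>prod_inverse_one_add\<close>). For composition, a right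
  inverse is a fixed point each degree of which is determined by the lower ones
  (\<open>mul_comp_right_inverse\<close>); since it is again of the same shape it has a right inverse too, and
  associativity (\<open>mul_comp_assoc\<close>) makes the inverse two-sided and unique.
\<close>

section \<open>Cutting a list into blocks\<close>

definition cuts :: "'a list \<Rightarrow> ('a list \<times> 'a list) set" where
  "cuts xs = {(u, v). u @ v = xs}"

text \<open>Two descriptions of a subdivision of the arguments into non-empty consecutive blocks are
  used. The list of blocks itself makes regrouping a matter of concatenation, which is what the
  product rule and associativity need. The list of block lengths ranges over a set that does not
  depend on the arguments, which is what linearity in one argument needs.\<close>

definition splittings :: "'a list \<Rightarrow> 'a list list set" where
  "splittings xs = {ls. concat ls = xs \<and> [] \<notin> set ls}"

definition compositions :: "nat \<Rightarrow> nat list set" where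
  "compositions n = {ps. 0 \<notin> set ps \<and> sum_list ps = n}"

fun blocks :: "nat list \<Rightarrow> 'a list \<Rightarrow> 'a list list" where
  "blocks [] xs = []"
| "blocks (p # ps) xs = take p xs # blocks ps (drop p xs)"

lemma blocks_map: "blocks ps (map f xs) = map (map f) (blocks ps xs)"
  by (induction ps arbitrary: xs) (auto simp: take_map drop_map)

lemma concat_blocks: "sum_list ps = length xs \<Longrightarrow> concat (blocks ps xs) = xs"
  by (induction ps arbitrary: xs) auto

lemma map_length_blocks: "sum_list ps = length xs \<Longrightarrow> map length (blocks ps xs) = ps"
  by (induction ps arbitrary: xs) auto

lemma blocks_concat: "blocks (map length ls) (concat ls) = ls"
  by (induction ls) auto

lemma blocks_nth:
  "map (\<lambda>j. take (ps ! j) (drop (sum_list (take j ps)) xs)) [0..<length ps] = blocks ps xs"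
proof (induction ps arbitrary: xs)
  case (Cons p ps)
  have "[0..<length (p # ps)] = 0 # map Suc [0..<length ps]"
    by (simp add: upt_conv_Cons map_Suc_upt del: upt_Suc)
  then show ?case
    using Cons[of "drop p xs"] by (simp add: o_def add.commute del: upt_Suc)
qed auto

lemma length_le_sum_list: "0 \<notin> set ps \<Longrightarrow> length ps \<le> sum_list ps"
  for ps :: "nat list"
  by (induction ps) auto

lemma finite_compositions [simp]: "finite (compositions n)"
proof -
  have "compositions n \<subseteq> {ps. set ps \<subseteq> {..n} \<and> length ps \<le> n}"
  proof
    fix ps assume ps: "ps \<in> compositions n"
    then show "ps \<in> {ps. set ps \<subseteq> {..n} \<and> length ps \<le> n}"
      by (auto simp: compositions_def intro: member_le_sum_list length_le_sum_list)
  qed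
  then show ?thesis
    by (rule finite_subset) (rule finite_lists_length_le, simp)
qed

lemma bij_betw_blocks:
  "bij_betw (\<lambda>ps. blocks ps xs) (compositions (length xs)) (splittings xs)"
proof (rule bij_betwI[where g = "map length"])
  show "(\<lambda>ps. blocks ps xs) \<in> compositions (length xs) \<rightarrow> splittings xs"
  proof
    fix ps assume ps: "ps \<in> compositions (length xs)"
    then have "map length (blocks ps xs) = ps"
      by (simp add: compositions_def map_length_blocks)
    then have "0 \<notin> length ` set (blocks ps xs)"
      using ps by (metis (mono_tags, lifting) compositions_def list.set_map mem_Collect_eq)
    then show "blocks ps xs \<in> splittings xs"
      using ps by (force simp: splittings_def compositions_def concat_blocks)
  qed
  show "map length \<in> splittings xs \<rightarrow> compositions (length xs)"
    by (auto simp: splittings_def compositions_def length_concat)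
qed (auto simp: splittings_def compositions_def map_length_blocks blocks_concat)

lemma finite_splittings [simp]: "finite (splittings xs)"
  using bij_betw_finite[OF bij_betw_blocks] by auto

text \<open>Splittings of \<open>map f xs\<close> and of \<open>xs\<close> correspond to each other through their block lengths.\<close>

lemma sum_splittings_map:
  "(\<Sum>ls\<in>splittings (map f xs). g ls) = (\<Sum>ls\<in>splittings xs. g (map (map f) ls))"
  using sum.reindex_bij_betw[OF bij_betw_blocks, of g "map f xs"]
    sum.reindex_bij_betw[OF bij_betw_blocks, of "\<lambda>ls. g (map (map f) ls)" xs]
  by (simp add: blocks_map)

section \<open>Formal product and composition as sums over cuts and splittings\<close>

lemma mul_comp_compositions:
  "(\<alpha> \<odot> \<beta>) bs = (\<Sum>ps\<in>compositions (length bs). \<alpha> (map \<beta> (blocks ps bs)))"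
proof (cases "bs = []")
  case True
  then have "compositions (length bs) = {[]}"
    by (auto simp: compositions_def) (metis list.set_intros(1) neq_Nil_conv)
  with True show ?thesis by (simp add: mul_comp_def)
next
  case False
  let ?C = "int_compositions (length bs)"
  have sub: "?C k \<subseteq> compositions (length bs)" for k
    by (force simp: int_compositions_def compositions_def)
  have union: "compositions (length bs) = (\<Union>k\<in>{1..length bs}. ?C k)"
  proof
    show "compositions (length bs) \<subseteq> (\<Union>k\<in>{1..length bs}. ?C k)"
    proof
      fix ps assume ps: "ps \<in> compositions (length bs)"
      then have "ps \<in> ?C (length ps)"
        by (auto simp: compositions_def int_compositions_def) 
          (metis not_less_eq_eq le0 le_antisym One_nat_def)
      moreover have "length ps \<in> {1..length bs}"
        using ps False length_le_sum_list[of ps] by (cases ps) (auto simp: compositions_def)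
      ultimately show "ps \<in> (\<Union>k\<in>{1..length bs}. ?C k)" by blast
    qed
  qed (use sub in blast)
  have "(\<Sum>ps\<in>compositions (length bs). \<alpha> (map \<beta> (blocks ps bs)))
      = (\<Sum>k=1..length bs. \<Sum>ps\<in>?C k. \<alpha> (map \<beta> (blocks ps bs)))"
    unfolding union
  proof (rule sum.UNION_disjoint)
    show "\<forall>k\<in>{1..length bs}. finite (?C k)"
      using sub finite_compositions finite_subset by blast
  qed (auto simp: int_compositions_def)
  also have "\<dots> = (\<alpha> \<odot> \<beta>) bs"
  proof -
    have "map (\<lambda>j. \<beta> (take (ps ! j) (drop (sum_list (take j ps)) bs))) [0..<k]
        = map \<beta> (blocks ps bs)" if "ps \<in> ?C k" for k ps
    proof -
      have "k = length ps" using that by (simp add: int_compositions_def)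
      then show ?thesis by (simp add: blocks_nth[symmetric])
    qed
    with False show ?thesis by (simp add: mul_comp_def)
  qed
  finally show ?thesis by simp
qed

lemma mul_comp_splittings:
  "(\<alpha> \<odot> \<beta>) bs = (\<Sum>ls\<in>splittings bs. \<alpha> (map \<beta> ls))"
  unfolding mul_comp_compositions
  by (rule sum.reindex_bij_betw[OF bij_betw_blocks, of "\<lambda>ls. \<alpha> (map \<beta> ls)"])

lemma length_splitting:
  "ls \<in> splittings xs \<Longrightarrow> length ls \<le> length xs"
  using length_le_sum_list[of "map length ls"]
  by (auto simp: splittings_def length_concat image_iff)

lemma bij_betw_cuts: "bij_betw (\<lambda>k. (take k xs, drop k xs)) {0..length xs} (cuts xs)"
  by (rule bij_betwI[where g = "\<lambda>(u, v). length u"]) (auto simp: cuts_def)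

lemma finite_cuts [simp]: "finite (cuts xs)"
  using bij_betw_finite[OF bij_betw_cuts] by auto

lemma sum_cuts:
  "(\<Sum>(u, v)\<in>cuts xs. f u v) = (\<Sum>k=0..length xs. f (take k xs) (drop k xs))"
  using sum.reindex_bij_betw[OF bij_betw_cuts, of "\<lambda>(u, v). f u v" xs] by simp

lemma mul_prod_cuts: "(\<alpha> \<otimes> \<beta>) bs = (\<Sum>(u, v)\<in>cuts bs. \<alpha> u * \<beta> v)"
  by (simp add: mul_prod_def sum_cuts)

lemma mul_prod_Cons: "(\<alpha> \<otimes> \<beta>) (b # bs) = \<alpha> [] * \<beta> (b # bs) + ((\<lambda>u. \<alpha> (b # u)) \<otimes> \<beta>) bs"
  by (simp add: mul_prod_def sum.atLeast0_atMost_Suc_shift del: sum.cl_ivl_Suc)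

lemma mul_prod_snoc: "(\<alpha> \<otimes> \<beta>) (bs @ [b]) = (\<alpha> \<otimes> (\<lambda>v. \<beta> (v @ [b]))) bs + \<alpha> (bs @ [b]) * \<beta> []"
  by (simp add: mul_prod_def)

section \<open>The ring structure, and composition as a homomorphism\<close>

lemma mul_prod_Nil [simp]: "(\<alpha> \<otimes> \<beta>) [] = \<alpha> [] * \<beta> []"
  by (simp add: mul_prod_def)

lemma mul_comp_Nil [simp]: "(\<alpha> \<odot> \<beta>) [] = \<alpha> []"
  by (simp add: mul_comp_def)

lemma mul_one_simps [simp]: "mul_one [] = 1" "mul_one (b # bs) = 0" "mul_one (bs @ [b]) = 0"
  by (simp_all add: mul_one_def)

lemma mul_id_simps [simp]: "mul_id [] = 0" "mul_id [b] = b" "mul_id (a # b # bs) = 0"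
  by (simp_all add: mul_id_def)

lemma mul_add_apply [simp]: "(\<alpha> \<oplus> \<beta>) bs = \<alpha> bs + \<beta> bs"
  by (simp add: mul_add_def)

lemma mul_one_prod [simp]: "mul_one \<otimes> \<alpha> = \<alpha>"
proof
  fix bs
  show "(mul_one \<otimes> \<alpha>) bs = \<alpha> bs"
    by (cases bs) (simp_all add: mul_prod_Cons, simp add: mul_prod_def)
qed

lemma mul_prod_one [simp]: "\<alpha> \<otimes> mul_one = \<alpha>"
proof
  fix bs
  show "(\<alpha> \<otimes> mul_one) bs = \<alpha> bs"
  proof (cases bs rule: rev_cases)
    case (snoc ys y)
    have "(\<lambda>v. mul_one (v @ [y])) = (\<lambda>v. 0::'a)" by (simp add: mul_one_def)
    then show ?thesis using snoc by (simp add: mul_prod_snoc) (simp add: mul_prod_def)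
  qed simp
qed

lemma mul_id_prod_Cons: "(mul_id \<otimes> \<alpha>) (b # bs) = b * \<alpha> bs"
proof -
  have "(\<lambda>u. mul_id (b # u)) = (\<lambda>u. b * mul_one u)"
    by (auto simp: mul_id_def mul_one_def split: list.split)
  then have "((\<lambda>u. mul_id (b # u)) \<otimes> \<alpha>) bs = b * (mul_one \<otimes> \<alpha>) bs"
    by (simp only:) (simp add: mul_prod_def sum_distrib_left mult.assoc del: mul_one_prod)
  then show ?thesis by (simp add: mul_prod_Cons)
qed

lemma mul_prod_id_snoc: "(\<alpha> \<otimes> mul_id) (bs @ [b]) = \<alpha> bs * b"
proof -
  have "(\<lambda>v. mul_id (v @ [b])) = (\<lambda>v. mul_one v * b)"
    by (auto simp: mul_id_def mul_one_def split: list.split)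
  then have "(\<alpha> \<otimes> (\<lambda>v. mul_id (v @ [b]))) bs = (\<alpha> \<otimes> mul_one) bs * b"
    by (simp only:) (simp add: mul_prod_def sum_distrib_right mult.assoc del: mul_prod_one)
  then show ?thesis by (simp add: mul_prod_snoc)
qed

lemma mul_prod_assoc: "(\<alpha> \<otimes> \<beta>) \<otimes> \<gamma> = \<alpha> \<otimes> (\<beta> \<otimes> \<gamma>)"
proof
  fix bs
  have "((\<alpha> \<otimes> \<beta>) \<otimes> \<gamma>) bs
      = (\<Sum>x\<in>cuts bs. \<Sum>y\<in>cuts (fst x). \<alpha> (fst y) * \<beta> (snd y) * \<gamma> (snd x))"
    by (simp add: mul_prod_cuts sum_distrib_right case_prod_unfold)
  also have "\<dots> = (\<Sum>(x, y)\<in>Sigma (cuts bs) (\<lambda>x. cuts (fst x)). \<alpha> (fst y) * \<beta> (snd y) * \<gamma> (snd x))"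
    by (rule sum.Sigma) auto
  also have "\<dots> = (\<Sum>(x, y)\<in>Sigma (cuts bs) (\<lambda>x. cuts (snd x)). \<alpha> (fst x) * (\<beta> (fst y) * \<gamma> (snd y)))"
    by (rule sum.reindex_bij_witness[where
          i = "\<lambda>(x, y). ((fst x @ fst y, snd y), (fst x, fst y))" and
          j = "\<lambda>(x, y). ((fst y, snd y @ snd x), (snd y, snd x))"])
       (auto simp: cuts_def mult.assoc)
  also have "\<dots> = (\<Sum>x\<in>cuts bs. \<Sum>y\<in>cuts (snd x). \<alpha> (fst x) * (\<beta> (fst y) * \<gamma> (snd y)))"
    by (rule sum.Sigma[symmetric]) auto
  also have "\<dots> = (\<alpha> \<otimes> (\<beta> \<otimes> \<gamma>)) bs"
    by (simp add: mul_prod_cuts sum_distrib_left case_prod_unfold)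
  finally show "((\<alpha> \<otimes> \<beta>) \<otimes> \<gamma>) bs = (\<alpha> \<otimes> (\<beta> \<otimes> \<gamma>)) bs" .
qed

lemma mul_prod_add_left: "(\<alpha> \<oplus> \<beta>) \<otimes> \<gamma> = \<alpha> \<otimes> \<gamma> \<oplus> \<beta> \<otimes> \<gamma>"
  by (rule ext) (simp add: mul_prod_def distrib_right sum.distrib)

lemma mul_prod_add_right: "\<alpha> \<otimes> (\<beta> \<oplus> \<gamma>) = \<alpha> \<otimes> \<beta> \<oplus> \<alpha> \<otimes> \<gamma>"
  by (rule ext) (simp add: mul_prod_def distrib_left sum.distrib)

lemma mul_comp_add: "(\<alpha> \<oplus> \<beta>) \<odot> \<gamma> = \<alpha> \<odot> \<gamma> \<oplus> \<beta> \<odot> \<gamma>"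
  by (rule ext) (simp add: mul_comp_splittings sum.distrib)

lemma mul_one_comp [simp]: "mul_one \<odot> \<gamma> = mul_one"
proof
  fix bs
  show "(mul_one \<odot> \<gamma>) bs = mul_one bs"
  proof (cases "bs = []")
    case False
    then have "mul_one (map \<gamma> ls) = 0" if "ls \<in> splittings bs" for ls
      using that by (auto simp: splittings_def mul_one_def)
    with False show ?thesis by (simp add: mul_comp_splittings mul_one_def)
  qed simp
qed

lemma mul_id_comp:
  assumes "\<gamma> [] = 0"
  shows "mul_id \<odot> \<gamma> = \<gamma>"
proof
  fix bs
  show "(mul_id \<odot> \<gamma>) bs = \<gamma> bs"
  proof (cases "bs = []")
    case False
    have "mul_id (map \<gamma> ls) = (if ls = [bs] then \<gamma> bs else 0)" if "ls \<in> splittings bs" for ls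
      using that False
      by (auto simp: splittings_def mul_id_def split: list.split)
    moreover have "[bs] \<in> splittings bs" using False by (simp add: splittings_def)
    ultimately show ?thesis by (simp add: mul_comp_splittings)
  qed (simp add: assms)
qed

text \<open>Splitting a list and then cutting the list of blocks in two is the same as cutting the list
  in two and then splitting both parts. In either description the data are a pair of block lists
  with given total concatenation.\<close>

lemma mul_prod_comp: "(\<alpha> \<otimes> \<beta>) \<odot> \<gamma> = (\<alpha> \<odot> \<gamma>) \<otimes> (\<beta> \<odot> \<gamma>)"
proof
  fix bs
  define g where "g = (\<lambda>x. \<alpha> (map \<gamma> (fst x)) * \<beta> (map \<gamma> (snd x)))"
  have "(\<alpha> \<otimes> \<beta>) (map \<gamma> ls) = (\<Sum>x\<in>cuts ls. g x)" for ls
    using sum_cuts[of "\<lambda>u v. g (u, v)" ls]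
    by (simp add: mul_prod_def g_def take_map drop_map case_prod_unfold)
  then have "((\<alpha> \<otimes> \<beta>) \<odot> \<gamma>) bs = (\<Sum>ls\<in>splittings bs. \<Sum>x\<in>cuts ls. g x)"
    by (simp add: mul_comp_splittings)
  also have "\<dots> = (\<Sum>(ls, x)\<in>Sigma (splittings bs) cuts. g x)"
    by (rule sum.Sigma) auto
  also have "\<dots> = (\<Sum>(y, x)\<in>Sigma (cuts bs) (\<lambda>y. splittings (fst y) \<times> splittings (snd y)). g x)"
    by (rule sum.reindex_bij_witness[where
          i = "\<lambda>(y, x). (fst x @ snd x, x)" and
          j = "\<lambda>(ls, x). ((concat (fst x), concat (snd x)), x)"])
       (auto simp: cuts_def splittings_def)
  also have "\<dots> = (\<Sum>y\<in>cuts bs. \<Sum>x\<in>splittings (fst y) \<times> splittings (snd y). g x)"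
    by (rule sum.Sigma[symmetric]) auto
  also have "\<dots> = ((\<alpha> \<odot> \<gamma>) \<otimes> (\<beta> \<odot> \<gamma>)) bs"
    by (simp add: mul_prod_cuts mul_comp_splittings case_prod_unfold g_def sum_product sum.cartesian_product)
  finally show "((\<alpha> \<otimes> \<beta>) \<odot> \<gamma>) bs = ((\<alpha> \<odot> \<gamma>) \<otimes> (\<beta> \<odot> \<gamma>)) bs" .
qed

lemma concat_concat: "concat (concat xss) = concat (map concat xss)"
  by (induction xss) auto

lemma listset_splittings:
  "listset (map splittings ls) = {ns. map concat ns = ls \<and> (\<forall>n\<in>set ns. [] \<notin> set n)}"
proof (induction ls)
  case (Cons l ls)
  show ?case
    unfolding list.map(2) listset.simps(2) Cons.IH set_Cons_def
    by (auto simp: splittings_def map_eq_Cons_conv)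
qed auto

lemma finite_listset_map:
  assumes "\<And>x. finite (A x)"
  shows "finite (listset (map A xs))"
proof (induction xs)
  case (Cons x xs)
  have "set_Cons B C = (\<lambda>(y, ys). y # ys) ` (B \<times> C)" for B :: "'b set" and C
    by (auto simp: set_Cons_def)
  with Cons assms show ?case by simp
qed simp

section \<open>Multilinearity\<close>

context unital_algebra
begin

sublocale pair: vector_space_pair scale scale
  by unfold_locales

lemma linear_iff_scale:
  "Vector_Spaces.linear scale scale f
     \<longleftrightarrow> (\<forall>x y. f (x + y) = f x + f y) \<and> (\<forall>a x. f (a *s x) = a *s f x)"
  by (simp add: Vector_Spaces.linear_iff vector_space_axioms)

lemma Mul_iff:
  "\<alpha> \<in> Mul scale \<longleftrightarrow>
     (\<forall>xs b c ys. \<alpha> (xs @ (b + c) # ys) = \<alpha> (xs @ b # ys) + \<alpha> (xs @ c # ys)) \<and>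
     (\<forall>xs a b ys. \<alpha> (xs @ (a *s b) # ys) = a *s \<alpha> (xs @ b # ys))"
  unfolding Mul_def mem_Collect_eq linear_iff_scale by blast

lemma Mul_linear: "\<alpha> \<in> Mul scale \<Longrightarrow> Vector_Spaces.linear scale scale (\<lambda>b. \<alpha> (xs @ b # ys))"
  by (simp add: Mul_def)

lemma MulI: "(\<And>xs ys. Vector_Spaces.linear scale scale (\<lambda>b. \<alpha> (xs @ b # ys))) \<Longrightarrow> \<alpha> \<in> Mul scale"
  by (simp add: Mul_def)

lemma Mul_zero: "\<alpha> \<in> Mul scale \<Longrightarrow> 0 \<in> set bs \<Longrightarrow> \<alpha> bs = 0"
  using pair.linear_0[OF Mul_linear] by (metis split_list)

lemma linear_mult:
  assumes "Vector_Spaces.linear scale scale f"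
  shows "Vector_Spaces.linear scale scale (\<lambda>b. f b * c)"
    and "Vector_Spaces.linear scale scale (\<lambda>b. c * f b)"
  using assms unfolding linear_iff_scale
  by (simp_all add: distrib_left distrib_right scale_mult_left scale_mult_right)

lemma Mul_add: "\<alpha> \<in> Mul scale \<Longrightarrow> \<beta> \<in> Mul scale \<Longrightarrow> \<alpha> \<oplus> \<beta> \<in> Mul scale"
  by (auto simp: Mul_def mul_add_def intro: pair.linear_compose_add)

lemma Mul_diff: "\<alpha> \<in> Mul scale \<Longrightarrow> \<beta> \<in> Mul scale \<Longrightarrow> (\<lambda>bs. \<alpha> bs - \<beta> bs) \<in> Mul scale"
  by (auto simp: Mul_def intro: pair.linear_compose_sub)

lemma Mul_id: "mul_id \<in> Mul scale"
  by (auto simp: Mul_iff mul_id_def split: list.split)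
    (auto simp: append_eq_Cons_conv Cons_eq_append_conv)

lemma Mul_prod:
  assumes "\<alpha> \<in> Mul scale" "\<beta> \<in> Mul scale"
  shows "\<alpha> \<otimes> \<beta> \<in> Mul scale"
proof (rule MulI)
  fix xs ys
  have "Vector_Spaces.linear scale scale
      (\<lambda>b. \<alpha> (take k (xs @ b # ys)) * \<beta> (drop k (xs @ b # ys)))" for k
  proof (cases "k \<le> length xs")
    case True
    then show ?thesis by (simp add: linear_mult Mul_linear[OF assms(2)])
  next
    case False
    then obtain m where "k = Suc (length xs + m)"
      by (metis less_iff_Suc_add not_le)
    then show ?thesis by (simp add: linear_mult Mul_linear[OF assms(1)])
  qed
  then show "Vector_Spaces.linear scale scale (\<lambda>b. (\<alpha> \<otimes> \<beta>) (xs @ b # ys))"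
    unfolding mul_prod_def length_append list.size(4)
    by (intro pair.linear_compose_sum ballI)
qed

text \<open>For fixed block lengths, a given argument always falls into the same position of the same
  block, and the other entries do not depend on it. Linearity of \<open>\<alpha> \<odot> \<beta>\<close> in that argument is then
  linearity of \<open>\<beta>\<close> in one slot followed by linearity of \<open>\<alpha>\<close> in one slot.\<close>

lemma blocks_around:
  assumes "sum_list ps = Suc (length xs + length ys)"
  obtains A u v C where "\<And>b. blocks ps (xs @ b # ys) = A @ (u @ b # v) # C"
  using assms
proof (induction ps arbitrary: xs thesis)
  case (Cons p ps)
  show ?case
  proof (cases "p \<le> length xs")
    case True
    with Cons.prems have "sum_list ps = Suc (length (drop p xs) + length ys)" by simp
    then obtain A u v C where "\<And>b. blocks ps (drop p xs @ b # ys) = A @ (u @ b # v) # C"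
      using Cons.IH by blast
    then have "blocks (p # ps) (xs @ b # ys) = (take p xs # A) @ (u @ b # v) # C" for b
      using True by simp
    then show ?thesis by (rule Cons.prems(1))
  next
    case False
    then obtain m where "p = Suc (length xs + m)"
      by (metis less_iff_Suc_add not_le)
    then have "blocks (p # ps) (xs @ b # ys) = [] @ (xs @ b # take m ys) # blocks ps (drop m ys)" for b
      by simp
    then show ?thesis by (rule Cons.prems(1))
  qed
qed simp

lemma Mul_comp:
  assumes \<alpha>: "\<alpha> \<in> Mul scale" and \<beta>: "\<beta> \<in> Mul scale"
  shows "\<alpha> \<odot> \<beta> \<in> Mul scale"
proof (rule MulI)
  fix xs ys
  have "Vector_Spaces.linear scale scale (\<lambda>b. \<alpha> (map \<beta> (blocks ps (xs @ b # ys))))"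
    if "ps \<in> compositions (Suc (length xs + length ys))" for ps
  proof -
    have "sum_list ps = Suc (length xs + length ys)"
      using that by (simp add: compositions_def)
    then obtain A u v C where "\<And>b. blocks ps (xs @ b # ys) = A @ (u @ b # v) # C"
      by (rule blocks_around) blast
    then show ?thesis
      using Vector_Spaces.linear_compose[OF Mul_linear[OF \<beta>, of u v] Mul_linear[OF \<alpha>, of "map \<beta> A" "map \<beta> C"]]
      by (simp add: o_def)
  qed
  then show "Vector_Spaces.linear scale scale (\<lambda>b. (\<alpha> \<odot> \<beta>) (xs @ b # ys))"
    unfolding mul_comp_compositions by (simp add: pair.linear_compose_sum)
qed

section \<open>Composition of multilinear sequences is a monoid\<close>

text \<open>Only the splitting into singletons contributes: any other one has a block on which \<open>mul_id\<close>
  vanishes, and a multilinear map with an argument \<open>0\<close> is \<open>0\<close>.\<close>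

lemma mul_comp_id:
  assumes "\<alpha> \<in> Mul scale"
  shows "\<alpha> \<odot> mul_id = \<alpha>"
proof
  fix bs :: "'b list"
  let ?s = "map (\<lambda>b. [b]) bs"
  have s: "?s \<in> splittings bs" by (auto simp: splittings_def)
  have "\<alpha> (map mul_id ls) = (if ls = ?s then \<alpha> bs else 0)" if ls: "ls \<in> splittings bs" for ls
  proof (cases "\<forall>l\<in>set ls. length l = 1")
    case True
    then have "ls = map (\<lambda>b. [b]) (concat ls)"
      by (induction ls) (auto simp: length_Suc_conv)
    with ls have "ls = ?s" by (simp add: splittings_def)
    then show ?thesis by (simp add: o_def)
  next
    case False
    then obtain l where "l \<in> set ls" "length l \<noteq> 1" by auto
    moreover from this have "mul_id l = (0::'b)"
      by (auto simp: mul_id_def split: list.split)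
    ultimately have "0 \<in> set (map mul_id ls :: 'b list)" by force
    moreover have "ls \<noteq> ?s" using False by auto
    ultimately show ?thesis using Mul_zero[OF assms] by simp
  qed
  with s show "(\<alpha> \<odot> mul_id) bs = \<alpha> bs" by (simp add: mul_comp_splittings)
qed

text \<open>The prefix \<open>cs\<close> collects the arguments that have already been expanded, as the induction
  expands one argument at a time.\<close>

lemma Mul_expand:
  assumes \<alpha>: "\<alpha> \<in> Mul scale" and fin: "\<And>x. finite (A x)"
  shows "\<alpha> (cs @ map (\<lambda>x. \<Sum>y\<in>A x. f y) xs) = (\<Sum>ys\<in>listset (map A xs). \<alpha> (cs @ map f ys))"
proof (induction xs arbitrary: cs)
  case (Cons x xs)
  let ?L = "listset (map A xs)"
  have "\<alpha> (cs @ map (\<lambda>x. \<Sum>y\<in>A x. f y) (x # xs))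
      = (\<Sum>y\<in>A x. \<alpha> ((cs @ [f y]) @ map (\<lambda>x. \<Sum>y\<in>A x. f y) xs))"
    using pair.linear_sum[OF Mul_linear[OF \<alpha>]] by simp
  also have "\<dots> = (\<Sum>y\<in>A x. \<Sum>ys\<in>?L. \<alpha> (cs @ map f (y # ys)))"
    unfolding Cons.IH by simp
  also have "\<dots> = (\<Sum>(y, ys)\<in>A x \<times> ?L. \<alpha> (cs @ map f (y # ys)))"
    by (rule sum.Sigma) (use fin finite_listset_map[of A] in auto)
  also have "\<dots> = (\<Sum>ys\<in>listset (map A (x # xs)). \<alpha> (cs @ map f ys))"
    by (rule sum.reindex_bij_witness[where i = "\<lambda>ys. (hd ys, tl ys)" and j = "\<lambda>(y, ys). y # ys"])
       (auto simp: set_Cons_def)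
  finally show ?case .
qed simp

text \<open>Both sides are sums over two-level bracketings of the arguments. On the left a splitting \<open>ms\<close>
  of the arguments is grouped further into \<open>ns\<close>, so that \<open>ms = concat ns\<close>. On the right the
  arguments are split into coarse blocks \<open>ls\<close> and multilinearity of \<open>\<alpha>\<close> expands the choice of a
  splitting of each of them, so that \<open>ls = map concat ns\<close>. Either way \<open>ns\<close> determines everything.\<close>

lemma mul_comp_assoc:
  assumes \<alpha>: "\<alpha> \<in> Mul scale"
  shows "(\<alpha> \<odot> \<beta>) \<odot> \<gamma> = \<alpha> \<odot> (\<beta> \<odot> \<gamma>)"
proof
  fix bs
  define f where "f = (\<lambda>m. \<beta> (map \<gamma> m))"
  have "((\<alpha> \<odot> \<beta>) \<odot> \<gamma>) bs = (\<Sum>ms\<in>splittings bs. \<Sum>ns\<in>splittings ms. \<alpha> (map f ns))"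
    by (simp add: mul_comp_splittings sum_splittings_map f_def o_def)
  also have "\<dots> = (\<Sum>(ms, ns)\<in>Sigma (splittings bs) splittings. \<alpha> (map f ns))"
    by (rule sum.Sigma) auto
  also have "\<dots> = (\<Sum>(ls, ns)\<in>Sigma (splittings bs) (\<lambda>ls. listset (map splittings ls)). \<alpha> (map f ns))"
  proof (rule sum.reindex_bij_witness[where
          i = "\<lambda>(ls, ns). (concat ns, ns)" and j = "\<lambda>(ms, ns). (map concat ns, ns)"])
    fix a assume "a \<in> Sigma (splittings bs) splittings"
    then show "(case a of (ms, ns) \<Rightarrow> (map concat ns, ns))
        \<in> Sigma (splittings bs) (\<lambda>ls. listset (map splittings ls))"
      unfolding listset_splittings
      by (auto simp: splittings_def concat_concat) (metis last_in_set)
  next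
    fix b assume "b \<in> Sigma (splittings bs) (\<lambda>ls. listset (map splittings ls))"
    then show "(case b of (ls, ns) \<Rightarrow> (concat ns, ns)) \<in> Sigma (splittings bs) splittings"
      unfolding listset_splittings
      by (auto simp: splittings_def concat_concat) (metis concat.simps(1) image_eqI)
  qed (auto simp: listset_splittings splittings_def)
  also have "\<dots> = (\<Sum>ls\<in>splittings bs. \<Sum>ns\<in>listset (map splittings ls). \<alpha> (map f ns))"
    by (rule sum.Sigma[symmetric]) (use finite_listset_map[of splittings] in auto)
  also have "\<dots> = (\<alpha> \<odot> (\<beta> \<odot> \<gamma>)) bs"
  proof -
    have inner: "\<beta> \<odot> \<gamma> = (\<lambda>l. \<Sum>m\<in>splittings l. f m)"
      by (rule ext) (simp add: mul_comp_splittings f_def)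
    show ?thesis
      unfolding mul_comp_splittings[of \<alpha>] inner
      using Mul_expand[OF \<alpha>, of splittings "[]" f] by simp
  qed
  finally show "((\<alpha> \<odot> \<beta>) \<odot> \<gamma>) bs = (\<alpha> \<odot> (\<beta> \<odot> \<gamma>)) bs" .
qed


section \<open>Inverses for the formal product\<close>

lemma prod_inverse_unique:
  assumes "\<alpha> \<otimes> \<gamma> = mul_one" "\<gamma>' \<otimes> \<alpha> = mul_one"
  shows "\<gamma> = \<gamma>'"
  using assms by (metis mul_prod_assoc mul_one_prod mul_prod_one)

lemma prod_inverse_eqI:
  assumes "\<gamma> \<in> Mul scale" "\<alpha> \<otimes> \<gamma> = mul_one" "\<gamma> \<otimes> \<alpha> = mul_one"
  shows "prod_inverse scale \<alpha> = \<gamma>"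
  unfolding prod_inverse_def
  by (rule the_equality) (use assms prod_inverse_unique in blast)+

text \<open>The geometric series \<open>1 - I + I\<^sup>2 - \<dots>\<close>: \<open>I\<^sup>n\<close> is concentrated in degree \<open>n\<close>, where it is the
  product of the arguments.\<close>

definition geometric :: "'b mulseq" where
  "geometric bs = (- 1) ^ length bs * prod_list bs"

lemma minus_one_power_mult: "(- 1) ^ n * x = (if even n then x else - x)"
  for x :: 'b
  by (induction n) (simp_all add: mult.assoc)

lemma Mul_geometric: "geometric \<in> Mul scale"
  by (auto simp: Mul_iff geometric_def minus_one_power_mult distrib_left distrib_right
      scale_mult_left scale_mult_right)

lemma geometric_inverse:
  "(mul_one \<oplus> mul_id) \<otimes> geometric = mul_one" "geometric \<otimes> (mul_one \<oplus> mul_id) = mul_one"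
proof -
  show "(mul_one \<oplus> mul_id) \<otimes> geometric = mul_one"
  proof
    fix bs
    show "((mul_one \<oplus> mul_id) \<otimes> geometric) bs = mul_one bs"
      by (cases bs) (auto simp: mul_prod_add_left mul_id_prod_Cons geometric_def minus_one_power_mult
          simp del: power_Suc)
  qed
  show "geometric \<otimes> (mul_one \<oplus> mul_id) = mul_one"
  proof
    fix bs
    show "(geometric \<otimes> (mul_one \<oplus> mul_id)) bs = mul_one bs"
      by (cases bs rule: rev_cases)
        (simp_all add: mul_prod_add_right mul_prod_id_snoc geometric_def minus_one_power_mult
          del: power_Suc)
  qed
qed

text \<open>The homomorphism \<open>_ \<odot> \<xi>\<close> sends \<open>1 + I\<close> to \<open>1 + \<xi>\<close>, hence the inverse of the former to an
  inverse of the latter; multilinearity is inherited from that of compositions.\<close>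

lemma prod_inverse_one_add:
  assumes "\<xi> \<in> Mul scale" and "\<xi> [] = 0"
  shows "prod_inverse scale (mul_one \<oplus> \<xi>) \<in> Mul scale"
    and "(mul_one \<oplus> \<xi>) \<otimes> prod_inverse scale (mul_one \<oplus> \<xi>) = mul_one"
    and "prod_inverse scale (mul_one \<oplus> \<xi>) \<otimes> (mul_one \<oplus> \<xi>) = mul_one"
proof -
  let ?\<gamma> = "geometric \<odot> \<xi>"
  have comp: "(mul_one \<oplus> mul_id) \<odot> \<xi> = mul_one \<oplus> \<xi>"
    by (simp add: mul_comp_add mul_id_comp assms(2))
  have Mul: "?\<gamma> \<in> Mul scale"
    using Mul_comp[OF Mul_geometric assms(1)] .
  have right: "(mul_one \<oplus> \<xi>) \<otimes> ?\<gamma> = mul_one"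
    unfolding comp[symmetric] mul_prod_comp[symmetric] geometric_inverse by simp
  have left: "?\<gamma> \<otimes> (mul_one \<oplus> \<xi>) = mul_one"
    unfolding comp[symmetric] mul_prod_comp[symmetric] geometric_inverse by simp
  have "prod_inverse scale (mul_one \<oplus> \<xi>) = ?\<gamma>"
    using prod_inverse_eqI[OF Mul right left] .
  with Mul right left show "prod_inverse scale (mul_one \<oplus> \<xi>) \<in> Mul scale"
    "(mul_one \<oplus> \<xi>) \<otimes> prod_inverse scale (mul_one \<oplus> \<xi>) = mul_one"
    "prod_inverse scale (mul_one \<oplus> \<xi>) \<otimes> (mul_one \<oplus> \<xi>) = mul_one" by simp_all
qed

section \<open>Inverses for formal composition\<close>

text \<open>When \<open>\<nu>\<close> has no terms of degree 0 or 1, only splittings into at least two non-empty blocks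
  contribute to \<open>\<nu> \<odot> \<gamma>\<close>, and such blocks are shorter than the whole list. The equation
  \<open>\<gamma> = I - \<nu> \<odot> \<gamma>\<close> is therefore a recursion on the degree.\<close>

lemma mul_comp_cong_short:
  assumes \<nu>: "\<And>bs. length bs \<le> 1 \<Longrightarrow> \<nu> bs = 0"
    and eq: "\<And>cs. length cs < length bs \<Longrightarrow> \<gamma> cs = \<delta> cs"
  shows "(\<nu> \<odot> \<gamma>) bs = (\<nu> \<odot> \<delta>) bs"
  unfolding mul_comp_splittings
proof (rule sum.cong[OF refl])
  fix ls assume ls: "ls \<in> splittings bs"
  show "\<nu> (map \<gamma> ls) = \<nu> (map \<delta> ls)"
  proof (cases "length ls \<le> 1")
    case False
    have "\<gamma> l = \<delta> l" if "l \<in> set ls" for l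
    proof (rule eq)
      obtain A C where A: "ls = A @ l # C" using split_list[OF \<open>l \<in> set ls\<close>] by blast
      with False have "A @ C \<noteq> []" by auto
      then obtain m where m: "m \<in> set (A @ C)" by (meson last_in_set)
      with A ls have "m \<noteq> []" by (auto simp: splittings_def)
      with m have "concat (A @ C) \<noteq> []" by (auto simp del: concat_append)
      moreover have "length bs = length l + length (concat (A @ C))"
        using ls A by (auto simp: splittings_def)
      ultimately show "length l < length bs" by simp
    qed
    then show ?thesis by (metis map_eq_conv)
  qed (simp add: \<nu>)
qed

text \<open>The fixed point is the limit of the iterates of \<open>\<gamma> \<mapsto> I - \<nu> \<odot> \<gamma>\<close>, whose degree-\<open>n\<close> part is
  constant from the \<open>n\<close>-th iterate on. Since every iterate is multilinear, so is the limit.\<close>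

lemma fixpoint_exists:
  assumes \<nu>: "\<nu> \<in> Mul scale" "\<And>bs. length bs \<le> 1 \<Longrightarrow> \<nu> bs = 0"
  obtains \<gamma> where "\<gamma> \<in> Mul scale" "\<And>bs. \<gamma> bs = mul_id bs - (\<nu> \<odot> \<gamma>) bs"
proof -
  define F where "F = (\<lambda>\<gamma> bs. mul_id bs - (\<nu> \<odot> \<gamma>) bs)"
  define G where "G n = (F ^^ n) mul_id" for n
  have G_Suc: "G (Suc n) = F (G n)" for n by (simp add: G_def)
  have G_Mul: "G n \<in> Mul scale" for n
    by (induction n) (simp add: G_def Mul_id, simp add: G_Suc, simp add: F_def Mul_diff Mul_id Mul_comp \<nu>(1))
  have step: "G (Suc n) bs = G n bs" if "length bs \<le> n" for n bs
    using that
  proof (induction n arbitrary: bs)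
    case 0
    then show ?case by (simp add: G_def F_def \<nu>)
  next
    case (Suc n)
    have "(\<nu> \<odot> G (Suc n)) bs = (\<nu> \<odot> G n) bs"
      by (rule mul_comp_cong_short[OF \<nu>(2)]) (use Suc in auto)
    then show ?case unfolding G_Suc[of "Suc n"] G_Suc[of n] by (simp add: F_def flip: G_Suc)
  qed
  have stable: "G n bs = G (length bs) bs" if "length bs \<le> n" for n bs
    using that by (induction n rule: dec_induct) (simp_all add: step)
  define \<gamma> where "\<gamma> bs = G (length bs) bs" for bs
  have "\<gamma> \<in> Mul scale"
  proof (rule MulI)
    fix xs ys
    have "(\<lambda>b. \<gamma> (xs @ b # ys)) = (\<lambda>b. G (Suc (length xs + length ys)) (xs @ b # ys))"
      by (simp add: \<gamma>_def)
    then show "Vector_Spaces.linear scale scale (\<lambda>b. \<gamma> (xs @ b # ys))"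
      by (simp add: Mul_linear[OF G_Mul])
  qed
  moreover have "\<gamma> bs = mul_id bs - (\<nu> \<odot> \<gamma>) bs" for bs
  proof -
    have "\<gamma> bs = G (Suc (length bs)) bs" by (simp add: \<gamma>_def step)
    also have "\<dots> = mul_id bs - (\<nu> \<odot> G (length bs)) bs" by (simp add: G_Suc F_def)
    also have "(\<nu> \<odot> G (length bs)) bs = (\<nu> \<odot> \<gamma>) bs"
      by (rule mul_comp_cong_short[OF \<nu>(2)]) (simp, unfold \<gamma>_def, rule stable, simp)
    finally show ?thesis .
  qed
  ultimately show ?thesis by (rule that)
qed

text \<open>With \<open>\<alpha> = I + \<nu>\<close>, the equation \<open>\<alpha> \<odot> \<gamma> = I\<close> is the fixed-point equation
  \<open>\<gamma> = I - \<nu> \<odot> \<gamma>\<close>. The properties of \<open>\<gamma>\<close> in degrees 0 and 1 are recorded so that \<open>\<gamma>\<close> satisfies the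
  hypotheses on \<open>\<alpha>\<close> in its turn.\<close>

lemma mul_comp_right_inverse:
  assumes \<alpha>: "\<alpha> \<in> Mul scale" "\<alpha> [] = 0" "\<And>b. \<alpha> [b] = b"
  obtains \<gamma> where "\<gamma> \<in> Mul scale" "\<gamma> [] = 0" "\<And>b. \<gamma> [b] = b" "\<alpha> \<odot> \<gamma> = mul_id"
proof -
  define \<nu> where "\<nu> = (\<lambda>bs. \<alpha> bs - mul_id bs)"
  have \<nu>_Mul: "\<nu> \<in> Mul scale"
    using \<alpha>(1) by (simp add: \<nu>_def Mul_diff Mul_id)
  have \<nu>_short: "\<nu> bs = 0" if "length bs \<le> 1" for bs
    using that \<alpha>(2,3) by (auto simp: \<nu>_def le_Suc_eq length_Suc_conv)
  obtain \<gamma> where \<gamma>: "\<gamma> \<in> Mul scale" and fp: "\<And>bs. \<gamma> bs = mul_id bs - (\<nu> \<odot> \<gamma>) bs"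
    using fixpoint_exists[OF \<nu>_Mul \<nu>_short] by blast
  have \<gamma>0: "\<gamma> [] = 0" using fp[of "[]"] \<nu>_short[of "[]"] by simp
  have "(\<nu> \<odot> \<gamma>) [b] = 0" for b
  proof -
    have "\<nu> (map \<gamma> ls) = 0" if "ls \<in> splittings [b]" for ls
      by (rule \<nu>_short) (use length_splitting[OF that] in simp)
    then show ?thesis by (simp add: mul_comp_splittings)
  qed
  then have \<gamma>1: "\<gamma> [b] = b" for b using fp[of "[b]"] by simp
  have "\<alpha> = mul_id \<oplus> \<nu>" by (simp add: \<nu>_def mul_add_def)
  then have "\<alpha> \<odot> \<gamma> = \<gamma> \<oplus> \<nu> \<odot> \<gamma>"
    by (simp add: mul_comp_add mul_id_comp \<gamma>0)
  also have "\<dots> = mul_id" using fp by (auto simp: mul_add_def)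
  finally show ?thesis using that \<gamma> \<gamma>0 \<gamma>1 by blast
qed

text \<open>The usual monoid argument: if \<open>\<gamma>\<close> is a right inverse of \<open>\<alpha>\<close> and \<open>\<delta>\<close> one of \<open>\<gamma>\<close>, then
  \<open>\<alpha> = \<alpha> \<odot> \<gamma> \<odot> \<delta> = \<delta>\<close>, so \<open>\<gamma>\<close> is a two-sided inverse and hence the only one.\<close>

lemma comp_inverse_right:
  assumes \<alpha>: "\<alpha> \<in> Mul scale" "\<alpha> [] = 0" "\<And>b. \<alpha> [b] = b"
  defines "\<sigma> \<equiv> comp_inverse scale \<alpha>"
  shows "\<sigma> \<in> Mul scale" "\<sigma> [] = 0" "\<alpha> \<odot> \<sigma> = mul_id"
proof -
  obtain \<gamma> where \<gamma>: "\<gamma> \<in> Mul scale" "\<gamma> [] = 0" "\<And>b. \<gamma> [b] = b" and right: "\<alpha> \<odot> \<gamma> = mul_id"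
    using mul_comp_right_inverse[OF \<alpha>] by blast
  obtain \<delta> where \<delta>: "\<delta> [] = 0" "\<gamma> \<odot> \<delta> = mul_id"
    using mul_comp_right_inverse[OF \<gamma>] by blast
  have "\<alpha> = (\<alpha> \<odot> \<gamma>) \<odot> \<delta>"
    using \<alpha>(1) by (simp add: mul_comp_assoc \<delta>(2) mul_comp_id)
  also have "\<dots> = \<delta>"
    by (simp add: right mul_id_comp \<delta>(1))
  finally have "\<alpha> = \<delta>" .
  with \<delta>(2) have left: "\<gamma> \<odot> \<alpha> = mul_id" by simp
  have "\<sigma> = \<gamma>"
    unfolding \<sigma>_def comp_inverse_def
  proof (rule the_equality)
    fix \<gamma>' assume \<gamma>': "\<gamma>' \<in> Mul scale \<and> \<gamma>' [] = 0 \<and> \<alpha> \<odot> \<gamma>' = mul_id \<and> \<gamma>' \<odot> \<alpha> = mul_id"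
    then have "\<gamma>' = \<gamma>' \<odot> (\<alpha> \<odot> \<gamma>)"
      using right by (simp add: mul_comp_id)
    also have "\<dots> = (\<gamma>' \<odot> \<alpha>) \<odot> \<gamma>"
      by (rule mul_comp_assoc[symmetric]) (use \<gamma>' in simp)
    also have "\<dots> = \<gamma>"
      using \<gamma>' \<gamma>(2) by (simp add: mul_id_comp)
    finally show "\<gamma>' = \<gamma>" .
  qed (use \<gamma> left right in simp)
  with \<gamma> right show "\<sigma> \<in> Mul scale" "\<sigma> [] = 0" "\<alpha> \<odot> \<sigma> = mul_id" by simp_all
qed

section \<open>The equation of the unsymmetrized R-transform\<close>

lemma prod_inverse_prod_id_eq_iff:
  assumes "\<rho> \<in> Mul scale"
  shows "\<sigma> = prod_inverse scale (mul_one \<oplus> mul_id \<otimes> \<rho>) \<otimes> mul_id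
      \<longleftrightarrow> (mul_one \<oplus> mul_id \<otimes> \<rho>) \<otimes> \<sigma> = mul_id"
proof -
  let ?u = "mul_one \<oplus> mul_id \<otimes> \<rho>"
  have "mul_id \<otimes> \<rho> \<in> Mul scale" "(mul_id \<otimes> \<rho>) [] = 0"
    using assms by (simp_all add: Mul_prod Mul_id)
  note inv = prod_inverse_one_add[OF this]
  have "?u \<otimes> (prod_inverse scale ?u \<otimes> mul_id) = mul_id"
    by (metis inv(2) mul_prod_assoc mul_one_prod)
  moreover have "prod_inverse scale ?u \<otimes> (?u \<otimes> \<sigma>) = \<sigma>"
    by (metis inv(3) mul_prod_assoc mul_one_prod)
  ultimately show ?thesis by metis
qed

text \<open>Here \<open>w\<close> is a right inverse of \<open>1 + b\<sigma>\<close> and \<open>wb\<close> plays the role of the R-transform. The point is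
  that \<open>I(wb) = \<sigma>b\<close>.\<close>

lemma R_equation_solution:
  assumes \<sigma>: "\<sigma> \<otimes> (mul_one \<oplus> b \<otimes> \<sigma>) = mul_id"
    and w: "(mul_one \<oplus> b \<otimes> \<sigma>) \<otimes> w = mul_one"
  shows "(mul_one \<oplus> mul_id \<otimes> (w \<otimes> b)) \<otimes> \<sigma> = mul_id"
proof -
  have "mul_id \<otimes> (w \<otimes> b) = \<sigma> \<otimes> ((mul_one \<oplus> b \<otimes> \<sigma>) \<otimes> w) \<otimes> b"
    unfolding \<sigma>[symmetric] by (simp only: mul_prod_assoc)
  also have "\<dots> = \<sigma> \<otimes> b" by (simp add: w)
  finally have "(mul_one \<oplus> mul_id \<otimes> (w \<otimes> b)) \<otimes> \<sigma> = \<sigma> \<otimes> (mul_one \<oplus> b \<otimes> \<sigma>)"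
    by (simp add: mul_prod_add_left mul_prod_add_right mul_prod_assoc)
  with \<sigma> show ?thesis by simp
qed

text \<open>Multiplying by \<open>\<tau>\<close> replaces the right factor \<open>\<sigma>\<close> by \<open>I\<close>, and a factor \<open>I\<close> on either side can be
  cancelled by inserting the argument \<open>1\<close>.\<close>

lemma R_equation_cancel:
  assumes eq: "(mul_one \<oplus> mul_id \<otimes> \<rho>) \<otimes> \<sigma> = (mul_one \<oplus> mul_id \<otimes> \<rho>') \<otimes> \<sigma>"
    and \<sigma>: "\<sigma> \<otimes> \<tau> = mul_id"
  shows "\<rho> = \<rho>'"
proof
  fix bs
  have "mul_id \<otimes> \<rho> \<otimes> \<sigma> = mul_id \<otimes> \<rho>' \<otimes> \<sigma>"
    using eq unfolding mul_prod_add_left by (simp add: fun_eq_iff)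
  then have "mul_id \<otimes> \<rho> \<otimes> (\<sigma> \<otimes> \<tau>) = mul_id \<otimes> \<rho>' \<otimes> (\<sigma> \<otimes> \<tau>)"
    by (simp flip: mul_prod_assoc)
  then have "(mul_id \<otimes> \<rho> \<otimes> mul_id) ((1 # bs) @ [1]) = (mul_id \<otimes> \<rho>' \<otimes> mul_id) ((1 # bs) @ [1])"
    by (simp add: \<sigma>)
  then show "\<rho> bs = \<rho>' bs"
    unfolding mul_prod_id_snoc mul_id_prod_Cons by simp
qed

end

theorem proposition6p11:
  fixes scale :: "'k::field \<Rightarrow> 'b::{ring,monoid_mult} \<Rightarrow> 'b"
    and \<beta> :: "'b mulseq"
  assumes "unital_algebra scale"
    and "\<beta> \<in> Mul scale"
  shows "R_tilde scale \<beta> \<in> Mul scale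
    \<and> comp_inverse scale (mul_id \<oplus> mul_id \<otimes> \<beta> \<otimes> mul_id)
        = prod_inverse scale (mul_one \<oplus> mul_id \<otimes> R_tilde scale \<beta>) \<otimes> mul_id
    \<and> (\<forall>\<rho> \<in> Mul scale.
         comp_inverse scale (mul_id \<oplus> mul_id \<otimes> \<beta> \<otimes> mul_id)
           = prod_inverse scale (mul_one \<oplus> mul_id \<otimes> \<rho>) \<otimes> mul_id
         \<longrightarrow> \<rho> = R_tilde scale \<beta>)"
proof -
  interpret unital_algebra scale by fact
  let ?\<alpha> = "mul_id \<oplus> mul_id \<otimes> \<beta> \<otimes> mul_id"
  let ?v = "mul_one \<oplus> \<beta> \<otimes> mul_id"
  define \<sigma> where "\<sigma> = comp_inverse scale ?\<alpha>"
  define b where "b = \<beta> \<odot> \<sigma>"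
  define w where "w = prod_inverse scale ?v \<odot> \<sigma>"
  have \<alpha>: "?\<alpha> \<in> Mul scale" "?\<alpha> [] = 0" "?\<alpha> [c] = c" for c
    using assms(2) mul_prod_id_snoc[of "mul_id \<otimes> \<beta>" "[]" c]
    by (simp_all add: Mul_add Mul_prod Mul_id)
  note \<sigma> = comp_inverse_right[OF \<alpha>, folded \<sigma>_def]
  have "\<beta> \<otimes> mul_id \<in> Mul scale" "(\<beta> \<otimes> mul_id) [] = 0"
    using assms(2) by (simp_all add: Mul_prod Mul_id)
  note v = prod_inverse_one_add[OF this]
  have v_comp: "?v \<odot> \<sigma> = mul_one \<oplus> b \<otimes> \<sigma>"
    by (simp add: mul_comp_add mul_prod_comp mul_id_comp \<sigma>(2) b_def)
  have w: "(mul_one \<oplus> b \<otimes> \<sigma>) \<otimes> w = mul_one"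
    unfolding v_comp[symmetric] w_def mul_prod_comp[symmetric] v by simp
  have \<sigma>_eq: "\<sigma> \<otimes> (mul_one \<oplus> b \<otimes> \<sigma>) = mul_id"
    using \<sigma>(3)
    by (simp only: mul_comp_add mul_prod_comp mul_id_comp[of \<sigma>] \<sigma>(2) b_def mul_prod_add_right
        mul_prod_assoc mul_prod_one)
  have R: "R_tilde scale \<beta> = w \<otimes> b"
    by (simp add: R_tilde_def \<sigma>_def w_def b_def mul_prod_comp)
  have R_Mul: "R_tilde scale \<beta> \<in> Mul scale"
    unfolding R w_def b_def using assms(2) v(1) \<sigma>(1) by (intro Mul_prod Mul_comp)
  have R_eq: "(mul_one \<oplus> mul_id \<otimes> R_tilde scale \<beta>) \<otimes> \<sigma> = mul_id"
    unfolding R by (rule R_equation_solution[OF \<sigma>_eq w])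
  show ?thesis
    unfolding \<sigma>_def[symmetric]
    using R_Mul R_eq R_equation_cancel[OF _ \<sigma>_eq]
    by (simp add: prod_inverse_prod_id_eq_iff)
qed

end
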